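(* Fix constants $k,\rho,c,\lambda,\Theta_\infty>0$ (hence $\alpha=\frac{k}{\rho c}$ and $\mathrm{Ste}=\frac{c\Theta_\infty}{\lambda}>0$). For $h>0$ let $\mathrm{Bi}=\frac{h\sqrt{\alpha}}{k}$ and let $(T_4,s_4)$, depending on $\mathrm{Bi}$, be the quadratic-profile solution of Problem (P4); let $(T_{4\infty},s_{4\infty})$ be the quadratic-profile solution of Problem (P4$_\infty$). Then the solution of (P4) converges to the solution of (P4$_\infty$) as $\mathrm{Bi}\to\infty$, that is, $$T_4(x,t)\to T_{4\infty}(x,t)\quad\text{and}\quad s_4(t)\to s_{4\infty}(t)\quad\text{when }\mathrm{Bi}\to\infty,$$ for every $t>0$ and $0<x<s_{4\infty}(t)$.
   Context: Problem (P4): find $s_4(t)$ and $T_4(x,t)$, $0\le x\le s_4(t)$, $t>0$, such that for all $t>0$: $\int_0^{s_{4}(t)}\int_0^x\frac{\partial T_4}{\partial t}(\eta,t)\,d\eta\,dx=-\frac{k}{\rho c}\left[T_{4}(0,t)+\frac{\partial T_4}{\partial x}(0,t)s_{4}(t)\right]$; $k\frac{\partial T_4}{\partial x}(0,t)=\frac{h}{\sqrt{t}}(T_{4}(0,t)+\Theta_{\infty})$; $T_{4}(s_{4}(t),t)=0$; $\left(\frac{\partial T_4}{\partial x}(s_{4}(t),t)\right)^2=-\frac{\lambda}{c}\frac{\partial^2T_4}{\partial x^2}(s_{4}(t),t)$; and $s_{4}(0)=0$. Problem (P4$_\infty$) is the same problem for $(T_{4\infty},s_{4\infty})$ with the second condition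 (the convective one) replaced by $T_{4\infty}(0,t)=-\Theta_\infty$, $t>0$. A quadratic-profile solution of either problem is one of the form $T(x,t)=-A\Theta_\infty\left(1-\frac{x}{s(t)}\right)-B\Theta_\infty\left(1-\frac{x}{s(t)}\right)^2$ with constants $A>0$, $B>0$. Each problem has exactly one such solution, and explicitly: (P4): $s_4(t)=2\xi_4\sqrt{\alpha t}$, $A=A_4=\frac{2\xi_{4}(3-\xi_4^{2})}{\frac{1}{\mathrm{Bi}}\xi_{4}^{2}+6\xi_{4}+\frac{3}{\mathrm{Bi}}}$, $B=B_4=\frac{2\xi_{4}^{3}}{\frac{1}{\mathrm{Bi}}\xi_{4}^{2}+6\xi_{4}+\frac{3}{\mathrm{Bi}}}$, where $\xi_4$ is the unique solution in $(0,\sqrt3)$ of $\mathrm{Ste}\,z^{4}-\frac{1}{\mathrm{Bi}}z^{3}-6(1+\mathrm{Ste})z^2-\frac{3}{\mathrm{Bi}}z+9\mathrm{Ste}=0$. (P4$_\infty$): $s_{4\infty}(t)=2\xi_{4\infty}\sqrt{\alpha t}$, $\xi_{4\infty}=\left(\frac{3\left((1+\mathrm{Ste})-\sqrt{2\mathrm{Ste}+1}\right)}{\mathrm{Ste}}\right)^{1/2}$, $A=A_{4\infty}=\frac{\sqrt{2\mathrm{Ste}+1}-1}{\mathrm{Ste}}$, $B=B_{4\infty}=\frac{1+\mathrm{Ste}-\sqrt{2\mathrm{Ste}+1}}{\mathrm{Ste}}$. *)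

theory Defs
  imports "HOL-Analysis.Analysis"
begin

definition diffusivity :: "real \<Rightarrow> real \<Rightarrow> real \<Rightarrow> real" where
  "diffusivity k \<rho> c = k / (\<rho> * c)"

definition biot :: "real \<Rightarrow> real \<Rightarrow> real \<Rightarrow> real \<Rightarrow> real" where
  "biot k \<rho> c h = h * sqrt (diffusivity k \<rho> c) / k"

text \<open>
  A temperature \<open>T x t\<close> is only meaningful on the region \<open>0 \<le> x \<le> s t\<close>, \<open>t > 0\<close>, so the
  derivatives with respect to \<open>x\<close> are taken within \<open>{0..s t}\<close> (one-sided at the end points) and
  the derivative with respect to \<open>t\<close> at interior points.  Nothing is assumed about the values of
  \<open>T\<close> outside the region.
\<close>

definition has_partials ::
  "(real \<Rightarrow> real \<Rightarrow> real) \<Rightarrow> (real \<Rightarrow> real) \<Rightarrow> (real \<Rightarrow> real \<Rightarrow> real) \<Rightarrow>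
   (real \<Rightarrow> real \<Rightarrow> real) \<Rightarrow> (real \<Rightarrow> real \<Rightarrow> real) \<Rightarrow> bool" where
  "has_partials T s Tt Tx Txx \<longleftrightarrow>
     (\<forall>t>0. \<forall>x\<in>{0..s t}.
        ((\<lambda>y. T y t) has_real_derivative Tx x t) (at x within {0..s t}) \<and>
        ((\<lambda>y. Tx y t) has_real_derivative Txx x t) (at x within {0..s t})) \<and>
     (\<forall>t>0. \<forall>x\<in>{0<..<s t}. ((\<lambda>u. T x u) has_real_derivative Tt x t) (at t))"

text \<open>
  The conditions shared by the two problems.  The boundary starts at the origin, is continuous up
  to time \<open>0\<close> (otherwise \<open>s 0 = 0\<close> would not constrain \<open>s\<close> on positive times), and leaves a
  nondegenerate region at every positive time.
\<close>

definition balance_conditions ::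
  "real \<Rightarrow> real \<Rightarrow> real \<Rightarrow> real \<Rightarrow> (real \<Rightarrow> real \<Rightarrow> real) \<Rightarrow> (real \<Rightarrow> real) \<Rightarrow>
   (real \<Rightarrow> real \<Rightarrow> real) \<Rightarrow> (real \<Rightarrow> real \<Rightarrow> real) \<Rightarrow> (real \<Rightarrow> real \<Rightarrow> real) \<Rightarrow> bool" where
  "balance_conditions k \<rho> c lam T s Tt Tx Txx \<longleftrightarrow>
     continuous_on {0..} s \<and> s 0 = 0 \<and> (\<forall>t>0. 0 < s t) \<and>
     has_partials T s Tt Tx Txx \<and>
     (\<forall>t>0.
        (\<lambda>\<eta>. Tt \<eta> t) integrable_on {0..s t} \<and>
        integral {0..s t} (\<lambda>x. integral {0..x} (\<lambda>\<eta>. Tt \<eta> t)) =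
          - (k / (\<rho> * c)) * (T 0 t + Tx 0 t * s t) \<and>
        T (s t) t = 0 \<and>
        (Tx (s t) t)\<^sup>2 = - (lam / c) * Txx (s t) t)"

definition solves_P4 ::
  "real \<Rightarrow> real \<Rightarrow> real \<Rightarrow> real \<Rightarrow> real \<Rightarrow> real \<Rightarrow> (real \<Rightarrow> real \<Rightarrow> real) \<Rightarrow> (real \<Rightarrow> real) \<Rightarrow> bool" where
  "solves_P4 k \<rho> c lam \<Theta> h T s \<longleftrightarrow>
     (\<exists>Tt Tx Txx. balance_conditions k \<rho> c lam T s Tt Tx Txx \<and>
        (\<forall>t>0. k * Tx 0 t = h / sqrt t * (T 0 t + \<Theta>)))"

definition solves_P4_inf ::
  "real \<Rightarrow> real \<Rightarrow> real \<Rightarrow> real \<Rightarrow> real \<Rightarrow> (real \<Rightarrow> real \<Rightarrow> real) \<Rightarrow> (real \<Rightarrow> real) \<Rightarrow> bool" where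
  "solves_P4_inf k \<rho> c lam \<Theta> T s \<longleftrightarrow>
     (\<exists>Tt Tx Txx. balance_conditions k \<rho> c lam T s Tt Tx Txx \<and>
        (\<forall>t>0. T 0 t = - \<Theta>))"

definition quadratic_profile :: "real \<Rightarrow> (real \<Rightarrow> real \<Rightarrow> real) \<Rightarrow> (real \<Rightarrow> real) \<Rightarrow> bool" where
  "quadratic_profile \<Theta> T s \<longleftrightarrow>
     (\<exists>A>0. \<exists>B>0. \<forall>t>0. \<forall>x\<in>{0..s t}.
        T x t = - A * \<Theta> * (1 - x / s t) - B * \<Theta> * (1 - x / s t)\<^sup>2)"

end

theory Submission
  imports Defs
begin

text \<open>
  Write \<open>S\<close> for the Stefan number. The free boundary condition forces \<open>B = S A\<^sup>2 / 2\<close>, and the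
  double integral condition becomes the differential equation \<open>s s' = 6 \<alpha> B / (A + B)\<close>, so that
  \<open>s\<^sup>2 = 12 \<alpha> t B / (A + B)\<close>. Both solutions are therefore the same continuous function of \<open>A\<close>
  alone, and only the condition at \<open>x = 0\<close> differs: it reads \<open>A + B = 1\<close> in the limit problem,
  while the convective condition gives \<open>A + B = 1 - O(1/Bi)\<close>. Since \<open>A \<mapsto> A + S A\<^sup>2 / 2\<close> has
  slope at least one for positive \<open>A\<close>, the coefficients \<open>A\<close> converge at rate \<open>1/Bi\<close>. The quartic
  equation for \<open>\<xi>\<close> is never needed.
\<close>

section \<open>Differentiating and integrating a quadratic profile\<close>

lemma has_real_derivative_unique_Icc:
  fixes f :: "real \<Rightarrow> real"
  assumes "a < b" "x \<in> {a..b}"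
    and "(f has_real_derivative D) (at x within {a..b})"
    and "(f has_real_derivative E) (at x within {a..b})"
  shows "D = E"
  using vector_derivative_unique_within_closed_interval[of a b x f D E] assms
  by (simp add: has_real_derivative_iff_has_vector_derivative)

text \<open>Derivatives within a nondegenerate closed interval are unique even at its end points, so
  the formula for \<open>f\<close> on \<open>{0..s}\<close> determines \<open>f'\<close> there.
  Since this holds on the whole interval, it can be differentiated once more.\<close>

lemma profile_space_derivatives:
  fixes p q s :: real
  assumes "0 < s"
    and f: "\<And>x. x \<in> {0..s} \<Longrightarrow> f x = - p * (1 - x / s) - q * (1 - x / s)\<^sup>2"
    and f': "\<And>x. x \<in> {0..s} \<Longrightarrow> (f has_real_derivative f' x) (at x within {0..s})"
    and f'': "\<And>x. x \<in> {0..s} \<Longrightarrow> (f' has_real_derivative f'' x) (at x within {0..s})"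
    and x: "x \<in> {0..s}"
  shows "f' x = (p + 2 * q * (1 - x / s)) / s" and "f'' x = - (2 * q) / s\<^sup>2"
proof -
  have 1: "f' y = (p + 2 * q * (1 - y / s)) / s" if y: "y \<in> {0..s}" for y
  proof -
    have "((\<lambda>x. - p * (1 - x / s) - q * (1 - x / s)\<^sup>2) has_real_derivative
            (p + 2 * q * (1 - y / s)) / s) (at y within {0..s})"
      using \<open>0 < s\<close> by (auto intro!: derivative_eq_intros simp: field_simps eval_nat_numeral)
    then have "(f has_real_derivative (p + 2 * q * (1 - y / s)) / s) (at y within {0..s})"
      by (rule has_field_derivative_transform_within[OF _ zero_less_one y]) (simp add: f)
    then show ?thesis
      using has_real_derivative_unique_Icc[OF \<open>0 < s\<close> y f'[OF y]] by blast
  qed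
  show "f' x = (p + 2 * q * (1 - x / s)) / s" using 1 x .
  have "((\<lambda>x. (p + 2 * q * (1 - x / s)) / s) has_real_derivative - (2 * q) / s\<^sup>2)
          (at x within {0..s})"
    using \<open>0 < s\<close> by (auto intro!: derivative_eq_intros simp: field_simps power2_eq_square)
  then have "(f' has_real_derivative - (2 * q) / s\<^sup>2) (at x within {0..s})"
    by (rule has_field_derivative_transform_within[OF _ zero_less_one x]) (simp add: 1)
  then show "f'' x = - (2 * q) / s\<^sup>2"
    using has_real_derivative_unique_Icc[OF \<open>0 < s\<close> x f''[OF x]] by blast
qed

text \<open>For \<open>r = \<Theta> * s' / s\<^sup>2\<close>, with \<open>s'\<close> the boundary
  speed, \<open>g\<close> is the time derivative of the profile at a fixed time, up to scaling of
  the coefficients. It is prescribed on the open interval only, as that is where the time derivative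
  is given.\<close>

lemma profile_moment_integral:
  fixes a b r s :: real
  assumes "0 < s"
    and g: "\<And>x. x \<in> {0<..<s} \<Longrightarrow> g x = - r * x * (a + 2 * b * (1 - x / s))"
  shows "integral {0..s} (\<lambda>x. integral {0..x} g) = - r * s ^ 3 * (a + b) / 6"
proof -
  \<comment> \<open>\<open>G\<close> and, below, \<open>H\<close> are successive primitives
    vanishing at 0, so the double integral is \<open>H s\<close>.\<close>
  define G where "G x = - r * ((a + 2 * b) * x\<^sup>2 / 2 - 2 * b * x ^ 3 / (3 * s))" for x
  have G: "(G has_real_derivative - r * y * (a + 2 * b * (1 - y / s))) (at y within X)" for y X
  proof -
    have "(G has_real_derivative - r * ((a + 2 * b) * (2 * y) / 2 - 2 * b * (3 * y\<^sup>2) / (3 * s)))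
        (at y within X)"
      unfolding G_def using \<open>0 < s\<close> by (auto intro!: derivative_eq_intros)
    also have "- r * ((a + 2 * b) * (2 * y) / 2 - 2 * b * (3 * y\<^sup>2) / (3 * s))
        = - r * y * (a + 2 * b * (1 - y / s))"
      using \<open>0 < s\<close> by (simp add: field_simps power2_eq_square)
    finally show ?thesis .
  qed
  have inner: "integral {0..x} g = G x" if x: "x \<in> {0..s}" for x
  proof -
    have I: "((\<lambda>y. - r * y * (a + 2 * b * (1 - y / s))) has_integral G x - G 0) {0..x}"
      using x G
      by (intro fundamental_theorem_of_calculus)
        (simp_all only: atLeastAtMost_iff has_real_derivative_iff_has_vector_derivative)
    have "integral {0..x} g = integral {0..x} (\<lambda>y. - r * y * (a + 2 * b * (1 - y / s)))"
      \<comment> \<open>The two end points, where \<open>g\<close> is unknown, form a null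
        set.\<close>
      by (rule integral_spike[of "{0, s}"]) (use x g in auto)
    also have "\<dots> = G x - G 0"
      by (rule integral_unique[OF I])
    also have "\<dots> = G x" by (simp add: G_def)
    finally show ?thesis .
  qed
  define H where "H x = - r * ((a + 2 * b) * x ^ 3 / 6 - b * x ^ 4 / (6 * s))" for x
  have H: "(H has_real_derivative G y) (at y within X)" for y X
  proof -
    have "(H has_real_derivative - r * ((a + 2 * b) * (3 * y\<^sup>2) / 6 - b * (4 * y ^ 3) / (6 * s)))
        (at y within X)"
      unfolding H_def using \<open>0 < s\<close> by (auto intro!: derivative_eq_intros)
    also have "- r * ((a + 2 * b) * (3 * y\<^sup>2) / 6 - b * (4 * y ^ 3) / (6 * s)) = G y"
      using \<open>0 < s\<close> by (simp add: G_def field_simps)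
    finally show ?thesis .
  qed
  have I: "(G has_integral H s - H 0) {0..s}"
    using \<open>0 < s\<close> H
    by (intro fundamental_theorem_of_calculus)
      (simp_all only: less_imp_le has_real_derivative_iff_has_vector_derivative)
  have "integral {0..s} (\<lambda>x. integral {0..x} g) = integral {0..s} G"
    by (rule Henstock_Kurzweil_Integration.integral_cong) (rule inner)
  also have "\<dots> = H s - H 0"
    by (rule integral_unique[OF I])
  also have "\<dots> = - r * s ^ 3 * (a + b) / 6"
    using \<open>0 < s\<close> by (simp add: H_def field_simps power4_eq_xxxx power3_eq_cube)
  finally show ?thesis .
qed

text \<open>The boundary is not assumed differentiable: at fixed \<open>x\<close> the profile is a quadratic in
  \<open>1 - x / s u\<close>, and solving it for \<open>s u\<close> transfers differentiability from the temperature.\<close>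
lemma profile_boundary_differentiable:
  fixes p q t x :: real
  assumes "0 < p" "0 < q" "0 < x" "x < s t"
    and prof: "eventually (\<lambda>u. x < s u \<and> f u = - p * (1 - x / s u) - q * (1 - x / s u)\<^sup>2) (nhds t)"
    and f: "(f has_real_derivative D) (at t)"
  obtains E where "(s has_real_derivative E) (at t)"
proof -
  \<comment> \<open>With \<open>w = 1 - x / s u\<close>, the profile reads
    \<open>q * w\<^sup>2 + p * w + y = 0\<close>. \<open>F\<close> takes its positive root
    \<open>w\<close> and returns \<open>x / (1 - w)\<close>, which is \<open>s u\<close>.\<close>
  define F where "F y = x / (1 - (sqrt (p\<^sup>2 - 4 * q * y) - p) / (2 * q))" for y
  have inv: "sqrt (p\<^sup>2 - 4 * q * f u) = p + 2 * q * (1 - x / s u)" "F (f u) = s u"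
    if u: "x < s u" "f u = - p * (1 - x / s u) - q * (1 - x / s u)\<^sup>2" for u
  proof -
    have w: "0 < 1 - x / s u" using u(1) \<open>0 < x\<close> by simp
    have "p\<^sup>2 - 4 * q * f u = (p + 2 * q * (1 - x / s u))\<^sup>2"
      unfolding u(2) by (simp add: power2_eq_square algebra_simps add_divide_distrib)
    moreover have "0 < p + 2 * q * (1 - x / s u)" using w assms by (simp add: add_pos_pos)
    ultimately show *: "sqrt (p\<^sup>2 - 4 * q * f u) = p + 2 * q * (1 - x / s u)" by simp
    show "F (f u) = s u"
      unfolding F_def * using assms(2,3) u(1) by (simp add: field_simps)
  qed
  have ft: "x < s t \<and> f t = - p * (1 - x / s t) - q * (1 - x / s t)\<^sup>2"
    using prof by (rule eventually_nhds_x_imp_x)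
  have sq: "sqrt (p\<^sup>2 - 4 * q * f t) = p + 2 * q * (1 - x / s t)" using inv ft by blast
  have "0 < 1 - x / s t" using ft \<open>0 < x\<close> by simp
  then have pos: "0 < p + 2 * q * (1 - x / s t)" using assms by (simp add: add_pos_pos)
  then have pos': "p\<^sup>2 - 4 * q * f t > 0" using sq by (metis real_sqrt_gt_0_iff)
  have ne: "1 - (sqrt (p\<^sup>2 - 4 * q * f t) - p) / (2 * q) \<noteq> 0"
    unfolding sq using assms by (simp add: field_simps)
  \<comment> \<open>Only existence matters, so the value \<open>E\<close> is left schematic and
    built up by the derivative rules.\<close>
  obtain E where E: "((\<lambda>u. F (f u)) has_real_derivative E) (at t)"
    unfolding F_def using pos' ne \<open>0 < q\<close>
    by atomize_elim (intro exI, (rule derivative_eq_intros f refl | simp)+)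
  have "eventually (\<lambda>u. F (f u) = s u) (nhds t)"
    using prof by eventually_elim (use inv in blast)
  from DERIV_cong_ev[OF refl this refl] E show thesis
    using that by blast
qed

section \<open>Coefficient relation and law of motion of the boundary\<close>

text \<open>Collects what the two problems share, with the coefficients fixed; the condition at
  \<open>x = 0\<close> that distinguishes them is left out.\<close>

locale quadratic_stefan =
  fixes k \<rho> c lam \<Theta> A B :: real
    and T :: "real \<Rightarrow> real \<Rightarrow> real" and s :: "real \<Rightarrow> real"
    and Tt Tx Txx :: "real \<Rightarrow> real \<Rightarrow> real"
  assumes pos: "0 < k" "0 < \<rho>" "0 < c" "0 < lam" "0 < \<Theta>" "0 < A" "0 < B"
    and bal: "balance_conditions k \<rho> c lam T s Tt Tx Txx"
    and prof: "\<And>t x. 0 < t \<Longrightarrow> x \<in> {0..s t} \<Longrightarrow>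
      T x t = - A * \<Theta> * (1 - x / s t) - B * \<Theta> * (1 - x / s t)\<^sup>2"
begin

lemma s_pos: "0 < t \<Longrightarrow> 0 < s t"
  using bal by (simp add: balance_conditions_def)

lemma T_zero: "0 < t \<Longrightarrow> T 0 t = - (A + B) * \<Theta>"
  using prof[of t 0] s_pos[of t] by (simp add: algebra_simps)

lemma
  assumes "0 < t" "x \<in> {0..s t}"
  shows Tx_eq: "Tx x t = (A + 2 * B * (1 - x / s t)) * \<Theta> / s t"
    and Txx_eq: "Txx x t = - (2 * B * \<Theta>) / (s t)\<^sup>2"
proof -
  have *: "\<And>x. x \<in> {0..s t} \<Longrightarrow>
      T x t = - (A * \<Theta>) * (1 - x / s t) - (B * \<Theta>) * (1 - x / s t)\<^sup>2"
    using prof[OF \<open>0 < t\<close>] by simp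
  have D: "\<And>x. x \<in> {0..s t} \<Longrightarrow> ((\<lambda>y. T y t) has_real_derivative Tx x t) (at x within {0..s t})"
    "\<And>x. x \<in> {0..s t} \<Longrightarrow> ((\<lambda>y. Tx y t) has_real_derivative Txx x t) (at x within {0..s t})"
    using bal \<open>0 < t\<close> by (auto simp: balance_conditions_def has_partials_def)
  note E = profile_space_derivatives[OF s_pos[OF \<open>0 < t\<close>] * D assms(2)]
  show "Tx x t = (A + 2 * B * (1 - x / s t)) * \<Theta> / s t"
    using E(1) by (simp add: algebra_simps)
  show "Txx x t = - (2 * B * \<Theta>) / (s t)\<^sup>2"
    using E(2) by (simp add: algebra_simps)
qed

text \<open>At the free boundary \<open>Tx\<close> is \<open>A * \<Theta> / s t\<close> and
  \<open>Txx\<close> is \<open>- 2 * B * \<Theta> / (s t)\<^sup>2\<close>, so \<open>s t\<close>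
  cancels from the quadratic boundary condition and evaluation at time 1 suffices.\<close>

lemma B_eq: "B = c * \<Theta> / lam * A\<^sup>2 / 2"
proof -
  have s: "0 < s 1" by (simp add: s_pos)
  have "(Tx (s 1) 1)\<^sup>2 = - (lam / c) * Txx (s 1) 1"
    using bal by (simp add: balance_conditions_def)
  then have "(A * \<Theta> / s 1)\<^sup>2 = lam / c * (2 * B * \<Theta>) / (s 1)\<^sup>2"
    using s by (simp add: Tx_eq Txx_eq)
  then have "(A * \<Theta>)\<^sup>2 = lam / c * (2 * B * \<Theta>)"
    using s pos by (simp add: power_divide field_simps)
  then show ?thesis
    using pos by (simp add: field_simps power2_eq_square)
qed

text \<open>At a fixed \<open>x\<close> the profile formula is available at time \<open>u\<close>
  only while \<open>x\<close> lies in \<open>{0..s u}\<close>. Continuity of \<open>s\<close>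
  secures this near \<open>t\<close>, which is what comparing time derivatives requires.\<close>

lemma eventually_less_s:
  assumes "0 < t" "x < s t"
  shows "eventually (\<lambda>u. 0 < u \<and> x < s u) (nhds t)"
proof -
  have "continuous_on {0<..} s"
    using bal by (auto simp: balance_conditions_def intro: continuous_on_subset)
  then have "isCont s t"
    using \<open>0 < t\<close> by (simp add: continuous_on_eq_continuous_at)
  then have "eventually (\<lambda>u. x < s u) (nhds t)"
    using order_tendstoD(1)[of s "s t" "nhds t" x] \<open>x < s t\<close>
    by (simp add: continuous_at tendsto_at_iff_tendsto_nhds)
  moreover have "eventually (\<lambda>u. 0 < u) (nhds t)"
    using \<open>0 < t\<close> eventually_nhds_in_open[of "{0<..}" t] by simp
  ultimately show ?thesis by (rule eventually_conj[rotated])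
qed

text \<open>Writing \<open>E\<close> for the derivative of \<open>s\<close>, the double integral
  equals \<open>- \<Theta> * E * s t * (A + B) / 6\<close>. The right-hand side of the balance is
  \<open>- diffusivity k \<rho> c * B * \<Theta>\<close>, and the equation is solved for
  \<open>E\<close>.\<close>

lemma s_DERIV:
  assumes "0 < t"
  shows "(s has_real_derivative 6 * diffusivity k \<rho> c * B / ((A + B) * s t)) (at t)"
proof -
  note st = s_pos[OF assms]
  have Tt: "((\<lambda>u. T x u) has_real_derivative Tt x t) (at t)" if "x \<in> {0<..<s t}" for x
    using bal that \<open>0 < t\<close> by (simp add: balance_conditions_def has_partials_def)
  have ev: "eventually (\<lambda>u. x < s u \<and>
      T x u = - (A * \<Theta>) * (1 - x / s u) - (B * \<Theta>) * (1 - x / s u)\<^sup>2) (nhds t)"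
    if "x \<in> {0<..<s t}" for x
    using eventually_less_s[of t x] that \<open>0 < t\<close>
    by (auto elim!: eventually_mono simp: prof)
  obtain E where E: "(s has_real_derivative E) (at t)"
  \<comment> \<open>The midpoint \<open>s t / 2\<close> is a convenient interior point, where the
    time derivative of \<open>T\<close> exists.\<close>
  proof (rule profile_boundary_differentiable[where p = "A * \<Theta>" and q = "B * \<Theta>"
      and s = s and t = t and x = "s t / 2" and f = "T (s t / 2)"])
    show "s t / 2 < s t" "0 < s t / 2" "0 < A * \<Theta>" "0 < B * \<Theta>" using st pos by auto
    show "eventually (\<lambda>u. s t / 2 < s u \<and> T (s t / 2) u
      = - (A * \<Theta>) * (1 - s t / 2 / s u) - (B * \<Theta>) * (1 - s t / 2 / s u)\<^sup>2) (nhds t)"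
      using ev[of "s t / 2"] st by simp
    show "((\<lambda>u. T (s t / 2) u) has_real_derivative Tt (s t / 2) t) (at t)"
      using Tt[of "s t / 2"] st by simp
  qed
  have Tt_eq: "Tt x t = - (\<Theta> * E / (s t)\<^sup>2) * x * (A + 2 * B * (1 - x / s t))"
    if x: "x \<in> {0<..<s t}" for x
  proof -
    have "((\<lambda>u. - (A * \<Theta>) * (1 - x / s u) - (B * \<Theta>) * (1 - x / s u)\<^sup>2) has_real_derivative
        - (\<Theta> * E / (s t)\<^sup>2) * x * (A + 2 * B * (1 - x / s t))) (at t)"
      using st by (auto intro!: derivative_eq_intros E simp: field_simps power2_eq_square)
    moreover have "((\<lambda>u. - (A * \<Theta>) * (1 - x / s u) - (B * \<Theta>) * (1 - x / s u)\<^sup>2)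
        has_real_derivative Tt x t) (at t)"
    proof (rule DERIV_cong_ev[OF refl _ refl, THEN iffD2, OF _ Tt[OF x]])
      show "eventually (\<lambda>u. - (A * \<Theta>) * (1 - x / s u) - (B * \<Theta>) * (1 - x / s u)\<^sup>2 = T x u)
          (nhds t)"
        using ev[OF x] by eventually_elim simp
    qed
    ultimately show ?thesis by (rule DERIV_unique[rotated])
  qed
  have flux: "T 0 t + Tx 0 t * s t = B * \<Theta>"
    using st \<open>0 < t\<close> by (simp add: T_zero Tx_eq) (simp add: algebra_simps)
  have "integral {0..s t} (\<lambda>x. integral {0..x} (\<lambda>\<eta>. Tt \<eta> t))
      = - (k / (\<rho> * c)) * (T 0 t + Tx 0 t * s t)"
    using bal \<open>0 < t\<close> by (simp add: balance_conditions_def)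
  also have "\<dots> = - diffusivity k \<rho> c * (B * \<Theta>)"
    by (simp add: flux diffusivity_def)
  finally have "(\<Theta> * E / (s t)\<^sup>2) * s t ^ 3 * (A + B) / 6 = diffusivity k \<rho> c * (B * \<Theta>)"
    using profile_moment_integral[OF st Tt_eq] by simp
  then have "\<Theta> * (E * (s t * (A + B))) = \<Theta> * (6 * diffusivity k \<rho> c * B)"
    using st by (simp add: field_simps power2_eq_square power3_eq_cube)
  then have "E * (s t * (A + B)) = 6 * diffusivity k \<rho> c * B"
    using pos by simp
  moreover have "(A + B) * s t \<noteq> 0"
    using st pos by simp
  ultimately have "E = 6 * diffusivity k \<rho> c * B / ((A + B) * s t)"
    by (simp add: nonzero_eq_divide_eq mult.commute)
  then show ?thesis using E by simp
qed

text \<open>The product of \<open>s\<close> and its derivative is the constant \<open>m / 2\<close>,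
  so \<open>(s u)\<^sup>2 - m * u\<close> is constant on positive times; continuity at time 0 and
  \<open>s 0 = 0\<close> fix the constant as 0.\<close>

lemma s_square:
  assumes "0 < t"
  shows "(s t)\<^sup>2 = 12 * diffusivity k \<rho> c * B / (A + B) * t"
proof -
  define m where "m = 12 * diffusivity k \<rho> c * B / (A + B)"
  have cont: "continuous_on {0..t} s"
    using bal by (auto simp: balance_conditions_def intro: continuous_on_subset)
  have "(s t)\<^sup>2 - m * t = (s 0)\<^sup>2 - m * 0"
  proof (rule DERIV_isconst_end[OF assms, where f = "\<lambda>u. (s u)\<^sup>2 - m * u"])
    show "continuous_on {0..t} (\<lambda>u. (s u)\<^sup>2 - m * u)"
      by (intro continuous_intros cont)
    fix u assume u: "0 < u" "u < t"
    have "2 * s u * (6 * diffusivity k \<rho> c * B / ((A + B) * s u)) = m"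
      using s_pos[OF u(1)] by (simp add: m_def)
    then show "((\<lambda>u. (s u)\<^sup>2 - m * u) has_real_derivative 0) (at u)"
      by (auto intro!: derivative_eq_intros s_DERIV[OF u(1)])
  qed
  moreover have "s 0 = 0" using bal by (simp add: balance_conditions_def)
  ultimately show ?thesis by (simp add: m_def)
qed

end

section \<open>Reduction to the single coefficient \<open>A\<close> and its rate of
  convergence\<close>

text \<open>Inserting \<open>B = S * A\<^sup>2 / 2\<close> turns \<open>B / (A + B)\<close> into
  \<open>S * A / (2 + S * A)\<close>, leaving \<open>A\<close> as the only unknown. The values at
  \<open>x = 0\<close> are supplied so that either remaining boundary condition can be turned into
  an equation for \<open>A\<close>.\<close>

lemma solution_form:
  assumes "0 < k" "0 < \<rho>" "0 < c" "0 < lam" "0 < \<Theta>"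
    and "balance_conditions k \<rho> c lam T s Tt Tx Txx" "quadratic_profile \<Theta> T s"
    and S: "S = c * \<Theta> / lam"
  obtains A where "0 < A"
    and "\<And>t. 0 < t \<Longrightarrow> s t = sqrt (12 * diffusivity k \<rho> c * (S * A / (2 + S * A)) * t)"
    and "\<And>t x. 0 < t \<Longrightarrow> x \<in> {0..s t} \<Longrightarrow>
      T x t = - A * \<Theta> * (1 - x / s t) - S * A\<^sup>2 / 2 * \<Theta> * (1 - x / s t)\<^sup>2"
    and "\<And>t. 0 < t \<Longrightarrow> T 0 t = - (A + S * A\<^sup>2 / 2) * \<Theta>"
    and "\<And>t. 0 < t \<Longrightarrow> Tx 0 t = (A + S * A\<^sup>2) * \<Theta> / s t"
proof -
  obtain A B where AB: "0 < A" "0 < B"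
    "\<And>t x. 0 < t \<Longrightarrow> x \<in> {0..s t} \<Longrightarrow>
      T x t = - A * \<Theta> * (1 - x / s t) - B * \<Theta> * (1 - x / s t)\<^sup>2"
    using assms(7) unfolding quadratic_profile_def by blast
  interpret quadratic_stefan k \<rho> c lam \<Theta> A B T s Tt Tx Txx
    by unfold_locales (use assms AB in auto)
  have S0: "0 < S" using assms by simp
  have B: "B = S * A\<^sup>2 / 2" using B_eq S by simp
  have "0 < 2 + S * A" using S0 AB by (simp add: add_pos_pos)
  moreover have "A + B = A * (2 + S * A) / 2"
    unfolding B by (simp add: power2_eq_square algebra_simps add_divide_distrib)
  ultimately have r: "B / (A + B) = S * A / (2 + S * A)"
    using AB(1) by (simp only: B) (simp add: power2_eq_square)
  show thesis
  proof (rule that[OF AB(1)])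
    show "s t = sqrt (12 * diffusivity k \<rho> c * (S * A / (2 + S * A)) * t)" if "0 < t" for t
    proof (rule real_sqrt_unique[symmetric])
      show "(s t)\<^sup>2 = 12 * diffusivity k \<rho> c * (S * A / (2 + S * A)) * t"
        unfolding r[symmetric] using s_square[OF that] by simp
    qed (use s_pos[OF that] in simp)
  qed (use AB(3) T_zero Tx_eq s_pos B in \<open>auto simp: less_imp_le\<close>)
qed

text \<open>The equation \<open>eq\<close> is the convective condition at time 1 in dimensionless
  form, with \<open>\<beta>\<close> the Biot number. Its left side is bounded in terms of
  \<open>S\<close> alone, so the defect \<open>1 - (A + S * A\<^sup>2 / 2)\<close> is of order
  \<open>1 / \<beta>\<close>, and the defect dominates the distance from \<open>A\<close> to
  \<open>a\<close>.\<close>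

lemma convective_defect_bound:
  fixes a S A \<beta> :: real
  assumes "0 < S" "0 < A" "0 < \<beta>"
    and eq: "(A + S * A\<^sup>2) / sqrt (12 * (S * A / (2 + S * A))) = \<beta> * (1 - (A + S * A\<^sup>2 / 2))"
    and a: "0 < a" "a + S * a\<^sup>2 / 2 = 1"
  shows "\<bar>A - a\<bar> \<le> (1 + S) * sqrt ((2 + S) / (12 * S)) / \<beta>"
proof -
  have SA: "0 < S * A" using assms by simp
  then have SA2: "0 < 2 + S * A" by simp
  have "0 < (A + S * A\<^sup>2) / sqrt (12 * (S * A / (2 + S * A)))"
    using \<open>0 < A\<close> \<open>0 < S\<close> SA SA2 by (simp add: add_pos_pos)
  \<comment> \<open>Positivity of the left side of \<open>eq\<close> makes the defect positive,
    which gives the bound \<open>A < 1\<close> needed for the uniform estimate.\<close>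
  from this[unfolded eq] have d: "0 < 1 - (A + S * A\<^sup>2 / 2)"
    using \<open>0 < \<beta>\<close> by (simp add: zero_less_mult_iff)
  moreover have "0 \<le> S * A\<^sup>2 / 2" using assms by simp
  ultimately have A1: "A < 1" by linarith
  have defect: "1 - (A + S * A\<^sup>2 / 2) = (a - A) * (1 + S * (A + a) / 2)"
  proof -
    have "(a - A) * (1 + S * (A + a) / 2) = (a + S * a\<^sup>2 / 2) - (A + S * A\<^sup>2 / 2)"
      by (simp add: power2_eq_square field_simps)
    then show ?thesis by (simp add: a(2))
  qed
  have ge1: "1 \<le> 1 + S * (A + a) / 2" using assms by simp
  then have "A < a" using d unfolding defect by (simp add: zero_less_mult_iff)
  then have "\<bar>A - a\<bar> \<le> (a - A) * (1 + S * (A + a) / 2)"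
    using mult_left_mono[OF ge1, of "a - A"] by simp
  also have "\<dots> = 1 - (A + S * A\<^sup>2 / 2)" by (rule defect[symmetric])
  also have "\<dots> = (A + S * A\<^sup>2) / sqrt (12 * (S * A / (2 + S * A))) / \<beta>"
    unfolding eq using \<open>0 < \<beta>\<close> by simp
  also have "\<dots> \<le> (1 + S) * sqrt ((2 + S) / (12 * S)) / \<beta>"
  proof (rule divide_right_mono)
    \<comment> \<open>The denominator vanishes as \<open>A\<close> tends to 0, but only like the
      square root of \<open>A\<close>: the squared quotient is
      \<open>A * (2 + S * A) / (12 * S)\<close>, which increases with \<open>A\<close>.\<close>
    have 1: "A / sqrt (12 * (S * A / (2 + S * A))) \<le> sqrt ((2 + S) / (12 * S))"
    proof (rule real_le_rsqrt)
      have "(A / sqrt (12 * (S * A / (2 + S * A))))\<^sup>2 = A\<^sup>2 / (12 * (S * A / (2 + S * A)))"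
        using SA SA2 by (simp add: power_divide)
      also have "\<dots> = A * (2 + S * A) / (12 * S)"
        using assms SA2 by (simp add: field_simps power2_eq_square)
      also have "\<dots> \<le> 1 * (2 + S * 1) / (12 * S)"
        using A1 assms SA2 by (intro divide_right_mono mult_mono add_mono mult_left_mono) auto
      finally show "(A / sqrt (12 * (S * A / (2 + S * A))))\<^sup>2 \<le> (2 + S) / (12 * S)" by simp
    qed
    have "(A + S * A\<^sup>2) / sqrt (12 * (S * A / (2 + S * A)))
        = (1 + S * A) * (A / sqrt (12 * (S * A / (2 + S * A))))"
      by (simp add: power2_eq_square algebra_simps)
    also have "\<dots> \<le> (1 + S) * sqrt ((2 + S) / (12 * S))"
      using A1 assms SA SA2 by (intro mult_mono 1 add_left_mono) auto
    finally show "(A + S * A\<^sup>2) / sqrt (12 * (S * A / (2 + S * A)))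
      \<le> (1 + S) * sqrt ((2 + S) / (12 * S))" .
  qed (use assms in simp)
  finally show ?thesis .
qed

section \<open>Passage to the limit of infinite Biot number\<close>

theorem theorem4p8:
  fixes k \<rho> c lam \<Theta> :: real
    and T4 :: "real \<Rightarrow> real \<Rightarrow> real \<Rightarrow> real" and s4 :: "real \<Rightarrow> real \<Rightarrow> real"
    and T4inf :: "real \<Rightarrow> real \<Rightarrow> real" and s4inf :: "real \<Rightarrow> real"
  assumes "k > 0" and "\<rho> > 0" and "c > 0" and "lam > 0" and "\<Theta> > 0"
    and "\<And>h. h > 0 \<Longrightarrow>
           solves_P4 k \<rho> c lam \<Theta> h (T4 (biot k \<rho> c h)) (s4 (biot k \<rho> c h)) \<and>
           quadratic_profile \<Theta> (T4 (biot k \<rho> c h)) (s4 (biot k \<rho> c h))"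
    and "solves_P4_inf k \<rho> c lam \<Theta> T4inf s4inf"
    and "quadratic_profile \<Theta> T4inf s4inf"
  shows "\<forall>t>0. ((\<lambda>Bi. s4 Bi t) \<longlongrightarrow> s4inf t) at_top \<and>
           (\<forall>x. 0 < x \<and> x < s4inf t \<longrightarrow> ((\<lambda>Bi. T4 Bi x t) \<longlongrightarrow> T4inf x t) at_top)"
proof -
  define \<alpha> where "\<alpha> = diffusivity k \<rho> c"
  define S where "S = c * \<Theta> / lam"
  have \<alpha>: "0 < \<alpha>" and S: "0 < S" using assms by (simp_all add: \<alpha>_def S_def diffusivity_def)
  \<comment> \<open>\<open>\<sigma>\<close> and \<open>\<tau>\<close> express boundary and
    temperature through \<open>A\<close>, so that both problems use the same two functions.\<close>
  define \<sigma> where "\<sigma> A t = sqrt (12 * \<alpha> * (S * A / (2 + S * A)) * t)" for A t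
  define \<tau> where
    "\<tau> A x t = - A * \<Theta> * (1 - x / \<sigma> A t) - S * A\<^sup>2 / 2 * \<Theta> * (1 - x / \<sigma> A t)\<^sup>2" for A x t
  have \<sigma>_pos: "0 < \<sigma> A t" if "0 < A" "0 < t" for A t
    using that S \<alpha> by (simp add: \<sigma>_def add_pos_pos)

  obtain Tt Tx Txx where inf: "balance_conditions k \<rho> c lam T4inf s4inf Tt Tx Txx"
    "\<And>t. 0 < t \<Longrightarrow> T4inf 0 t = - \<Theta>"
    using assms(7) unfolding solves_P4_inf_def by blast
  obtain a where a: "0 < a" "\<And>t. 0 < t \<Longrightarrow> s4inf t = \<sigma> a t"
    "\<And>t x. 0 < t \<Longrightarrow> x \<in> {0..\<sigma> a t} \<Longrightarrow> T4inf x t = \<tau> a x t"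
    "T4inf 0 1 = - (a + S * a\<^sup>2 / 2) * \<Theta>"
    by (rule solution_form[OF assms(1-5) inf(1) assms(8) S_def])
      (auto simp: \<sigma>_def \<tau>_def \<alpha>_def)
  have a1: "a + S * a\<^sup>2 / 2 = 1"
  proof -
    have "(a + S * a\<^sup>2 / 2) * \<Theta> = 1 * \<Theta>"
      using a(4) inf(2)[of 1] by (simp only: minus_mult_left[symmetric])
    then show ?thesis
      using \<open>0 < \<Theta>\<close> by simp
  qed

  define C where "C = (1 + S) * sqrt ((2 + S) / (12 * S))"
  have "\<exists>A. 0 < A \<and> (\<forall>t>0. s4 Bi t = \<sigma> A t) \<and>
      (\<forall>t>0. \<forall>x\<in>{0..\<sigma> A t}. T4 Bi x t = \<tau> A x t) \<and> \<bar>A - a\<bar> \<le> C / Bi" if "0 < Bi" for Bi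
  proof -
    \<comment> \<open>This inverts the definition of \<open>biot\<close>, so every positive
      \<open>Bi\<close> is attained by a positive \<open>h\<close>.\<close>
    define h where "h = Bi * k / sqrt \<alpha>"
    have h: "0 < h" "biot k \<rho> c h = Bi"
      using that \<alpha> assms by (simp_all add: h_def biot_def \<alpha>_def[symmetric])
    have "solves_P4 k \<rho> c lam \<Theta> h (T4 Bi) (s4 Bi)" and quad: "quadratic_profile \<Theta> (T4 Bi) (s4 Bi)"
      using assms(6)[OF h(1)] h(2) by auto
    then obtain Tt Tx Txx where bal: "balance_conditions k \<rho> c lam (T4 Bi) (s4 Bi) Tt Tx Txx"
      and conv: "\<And>t. 0 < t \<Longrightarrow> k * Tx 0 t = h / sqrt t * (T4 Bi 0 t + \<Theta>)"
      unfolding solves_P4_def by blast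
    obtain A where A: "0 < A" "\<And>t. 0 < t \<Longrightarrow> s4 Bi t = \<sigma> A t"
      "\<And>t x. 0 < t \<Longrightarrow> x \<in> {0..\<sigma> A t} \<Longrightarrow> T4 Bi x t = \<tau> A x t"
      "T4 Bi 0 1 = - (A + S * A\<^sup>2 / 2) * \<Theta>" "Tx 0 1 = (A + S * A\<^sup>2) * \<Theta> / \<sigma> A 1"
      by (rule solution_form[OF assms(1-5) bal quad S_def])
        (auto simp: \<sigma>_def \<tau>_def \<alpha>_def)
    define r where "r = sqrt (12 * (S * A / (2 + S * A)))"
    have r: "0 < r" using A(1) S by (simp add: r_def add_pos_pos)
    have \<sigma>1: "\<sigma> A 1 = sqrt \<alpha> * r"
      by (simp add: \<sigma>_def r_def real_sqrt_mult[symmetric] mult_ac)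
    \<comment> \<open>Both sides of the convective condition scale like \<open>1 / sqrt t\<close>,
      so time 1 carries all its information. The common factor
      \<open>k * \<Theta> / sqrt \<alpha>\<close> is cancelled next.\<close>
    have "k * ((A + S * A\<^sup>2) * \<Theta> / (sqrt \<alpha> * r)) = h * (\<Theta> * (1 - (A + S * A\<^sup>2 / 2)))"
      using conv[of 1] unfolding A(4,5) \<sigma>1 by (simp add: algebra_simps)
    then have "(k * \<Theta> / sqrt \<alpha>) * ((A + S * A\<^sup>2) / r)
        = (k * \<Theta> / sqrt \<alpha>) * (Bi * (1 - (A + S * A\<^sup>2 / 2)))"
      by (simp add: h_def mult_ac)
    then have "(A + S * A\<^sup>2) / r = Bi * (1 - (A + S * A\<^sup>2 / 2))"
      using assms(1,5) \<alpha> by (subst (asm) mult_left_cancel) auto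
    then have "\<bar>A - a\<bar> \<le> C / Bi"
      unfolding C_def r_def using convective_defect_bound[OF S A(1) that _ a(1) a1] by blast
    then show ?thesis using A(1-3) by blast
  qed
  then obtain A where A: "\<And>Bi. 0 < Bi \<Longrightarrow> 0 < A Bi"
    "\<And>Bi t. 0 < Bi \<Longrightarrow> 0 < t \<Longrightarrow> s4 Bi t = \<sigma> (A Bi) t"
    "\<And>Bi t x. 0 < Bi \<Longrightarrow> 0 < t \<Longrightarrow> x \<in> {0..\<sigma> (A Bi) t} \<Longrightarrow> T4 Bi x t = \<tau> (A Bi) x t"
    "\<And>Bi. 0 < Bi \<Longrightarrow> \<bar>A Bi - a\<bar> \<le> C / Bi"
    by metis
  have ev0: "eventually (\<lambda>Bi::real. 0 < Bi) at_top" by (rule eventually_gt_at_top)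
  have "((\<lambda>Bi. C / Bi) \<longlongrightarrow> 0) at_top"
    by (rule real_tendsto_divide_at_top[OF tendsto_const filterlim_ident])
  then have "((\<lambda>Bi. A Bi - a) \<longlongrightarrow> 0) at_top"
    by (rule Lim_null_comparison[rotated]) (use ev0 in eventually_elim, simp add: A(4))
  then have lim: "(A \<longlongrightarrow> a) at_top" by (simp add: LIM_zero_iff)
  show ?thesis
  proof (intro allI impI conjI; (elim conjE)?)
    fix t :: real assume t: "0 < t"
    have "2 + S * a \<noteq> 0" using mult_pos_pos[OF S a(1)] by linarith
    then have \<sigma>lim: "((\<lambda>Bi. \<sigma> (A Bi) t) \<longlongrightarrow> \<sigma> a t) at_top"
      unfolding \<sigma>_def by (intro tendsto_intros lim)
    then show "((\<lambda>Bi. s4 Bi t) \<longlongrightarrow> s4inf t) at_top"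
      unfolding a(2)[OF t]
      by (rule Lim_transform_eventually) (use ev0 in eventually_elim, simp add: A(2) t)
    fix x assume x: "0 < x" "x < s4inf t"
    have "\<sigma> a t \<noteq> 0" using \<sigma>_pos[OF a(1) t] by simp
    then have "((\<lambda>Bi. \<tau> (A Bi) x t) \<longlongrightarrow> \<tau> a x t) at_top"
      unfolding \<tau>_def by (intro tendsto_intros lim \<sigma>lim) simp_all
    \<comment> \<open>The formula for \<open>T4 Bi\<close> holds only up to its own boundary. As
      \<open>x\<close> lies strictly below the limit boundary, it lies below
      \<open>\<sigma> (A Bi) t\<close> for all large \<open>Bi\<close>.\<close>
    moreover have "eventually (\<lambda>Bi. x < \<sigma> (A Bi) t) at_top"
      using order_tendstoD(1)[OF \<sigma>lim] x(2) a(2)[OF t] by simp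
    with ev0 have "eventually (\<lambda>Bi. \<tau> (A Bi) x t = T4 Bi x t) at_top"
      by eventually_elim (use x(1) in \<open>simp add: A(3) t\<close>)
    moreover have "T4inf x t = \<tau> a x t" using a(2,3) t x by simp
    ultimately show "((\<lambda>Bi. T4 Bi x t) \<longlongrightarrow> T4inf x t) at_top"
      by (simp add: Lim_transform_eventually)
  qed
qed

end
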